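(* Let $K$ be a field of characteristic $0$, let $x,y$ be two generic traceless $2\times 2$ matrices over $K$, let $W$ be the associative algebra generated by $x,y$, let $L$ be the Lie subalgebra of $W$ generated by $x,y$ (so that $L\cong F_2(sl_2(K))$), and let $t=\mathrm{tr}(x^2)$, $u=\mathrm{tr}(y^2)$, $v=\mathrm{tr}(xy)$. (i) The commutator ideal $L'=[L,L]$ of $L$ is a free $K[t,u,v]$-module of rank $3$, with free generators $$xv-yt,\quad xu-yv,\quad [x,y].$$ (ii) The elements of $$L'=(xv-yt)K[t,u,v]\oplus (xu-yv)K[t,u,v]\oplus [x,y]K[t,u,v]$$ can be expressed in Lie form using the following identities, valid for all integers $a,b,c\ge 0$ subject to the indicated restrictions: $$2^{a+b+c+1}(xv-yt)t^au^bv^c=[x,y,y](\mathrm{ad}\,y)^{2b-1}(\mathrm{ad}\,x)^{2a+1}(\mathrm{ad}\,y\,\mathrm{ad}\,x)^c,\quad b>0,$$ $$2^{a+c+1}(xv-yt)t^av^c=[x,y,x](\mathrm{ad}\,x)^{2a}(\mathrm{ad}\,y\,\mathrm{ad}\,x)^c,$$ $$2^{a+b+c+1}(xu-yv)t^au^bv^c=[x,y,x](\mathrm{ad}\,x)^{2a-1}(\mathrm{ad}\,y)^{2b+1}(\mathrm{ad}\,x\,\mathrm{ad}\,y)^c,\quad a>0,$$ $$2^{b+c+1}(xu-yv)u^bv^c=[x,y,y](\mathrm{ad}\,y)^{2b}(\mathrm{ad}\,x\,\mathrm{ad}\,y)^c,$$ $$2^{a+b+c}[x,y]t^au^bv^c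=[x,y](\mathrm{ad}\,x)^{2a}(\mathrm{ad}\,y)^{2b}(\mathrm{ad}\,x\,\mathrm{ad}\,y)^c.$$
   Context: The generic traceless matrices are $x=\begin{pmatrix} x_{11} & x_{12} \\ x_{21} & -x_{11} \end{pmatrix}$ and $y=\begin{pmatrix} y_{11} & y_{12} \\ y_{21} & -y_{11} \end{pmatrix}$, where $x_{11},x_{12},x_{21},y_{11},y_{12},y_{21}$ are algebraically independent commuting variables over $K$. $W$ is the (unital) subalgebra of $M_2(K[x_{ij},y_{ij}])$ generated by $x,y$; a polynomial $f\in K[x_{ij},y_{ij}]$ is identified with the scalar matrix with $f$ on the diagonal, and with this identification $t,u,v\in W$ are algebraically independent, generate the centre of $W$, and $W$ is a free $K[t,u,v]$-module with basis $1,x,y,[x,y]$. The module structure on $L'$ is multiplication by elements of $K[t,u,v]$ inside $W$. $F_2(sl_2(K))$ denotes the relatively free Lie algebra of rank $2$ in the variety of Lie algebras generated by $sl_2(K)$. $L$ is the smallest subspace of $W$ containing $x,y$ and closed under $[z_1,z_2]=z_1z_2-z_2z_1$. The operators $\mathrm{ad}$ act on the right: $z_1\,\mathrm{ad}\,z_2=[z_1,z_2]$, and products of such operators are applied from left to right. Commutators are left normed: $[z_1,\ldots,z_{n-1},z_n]=[[z_1,\ldots,z_{n-1}],z_n]$. *)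

theory Defs
  imports "HOL-Analysis.Analysis" "HOL-Library.Poly_Mapping"
begin

datatype gvar = X11 | X12 | X21 | Y11 | Y12 | Y21

text \<open>
  The polynomial ring \<open>K[x\<^sub>i\<^sub>j, y\<^sub>i\<^sub>j]\<close> as the monoid algebra over \<open>K\<close> of the free commutative
  monoid on the six variables: a finitely supported map from exponent vectors to coefficients,
  with the convolution product of \<^theory>\<open>HOL-Library.Poly_Mapping\<close>.
\<close>

type_synonym 'k gpoly = "(gvar \<Rightarrow>\<^sub>0 nat) \<Rightarrow>\<^sub>0 'k"
type_synonym 'k gmat = "'k gpoly ^ 2 ^ 2"

definition Const :: "'k::field_char_0 \<Rightarrow> 'k gpoly"
  where "Const c = Poly_Mapping.single 0 c"

definition Var :: "gvar \<Rightarrow> 'k::field_char_0 gpoly"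
  where "Var i = Poly_Mapping.single (Poly_Mapping.single i 1) 1"

text \<open>
  The product of matrices is \<open>**\<close>; the class operation \<open>*\<close> on vectors is componentwise and is
  never used on matrices.  A polynomial \<open>f\<close> is identified with the scalar matrix \<open>mat f\<close>.
\<close>

definition generic_x :: "'k::field_char_0 gmat"
  where "generic_x = vector [vector [Var X11, Var X12], vector [Var X21, - Var X11]]"

definition generic_y :: "'k::field_char_0 gmat"
  where "generic_y = vector [vector [Var Y11, Var Y12], vector [Var Y21, - Var Y11]]"

definition kscale :: "'k::field_char_0 \<Rightarrow> 'k gmat \<Rightarrow> 'k gmat"
  where "kscale c A = mat (Const c) ** A"

lemma mat_add: "mat (a + b) = mat a + (mat b :: 'a::semiring_1 ^ 'n ^ 'n)"
  by (simp add: mat_def vec_eq_iff)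

lemma mat_mult: "mat (a * b) = mat a ** (mat b :: 'a::semiring_1 ^ 'n ^ 'n)"
  by (simp add: mat_def matrix_matrix_mult_def vec_eq_iff mult_delta_left mult_delta_right)

global_interpretation kmat: vector_space "kscale :: 'k::field_char_0 \<Rightarrow> 'k gmat \<Rightarrow> 'k gmat"
proof
  fix a b :: 'k and A B :: "'k gmat"
  show "kscale a (A + B) = kscale a A + kscale a B"
    by (simp add: kscale_def matrix_add_ldistrib)
  show "kscale (a + b) A = kscale a A + kscale b A"
    by (simp add: kscale_def Const_def single_add mat_add matrix_matrix_mult_def vec_eq_iff
        distrib_right sum.distrib)
  show "kscale a (kscale b A) = kscale (a * b) A"
    unfolding kscale_def Const_def matrix_mul_assoc mat_mult[symmetric] by (simp add: mult_single)
  show "kscale 1 A = A"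
    by (simp add: kscale_def Const_def)
qed

definition subalgebra :: "'k::field_char_0 gmat set \<Rightarrow> bool"
  where "subalgebra S \<longleftrightarrow> kmat.subspace S \<and> mat 1 \<in> S \<and> (\<forall>A\<in>S. \<forall>B\<in>S. A ** B \<in> S)"

definition comm :: "'k::field_char_0 gmat \<Rightarrow> 'k gmat \<Rightarrow> 'k gmat"
  where "comm A B = A ** B - B ** A"

definition lie_subalgebra :: "'k::field_char_0 gmat set \<Rightarrow> bool"
  where "lie_subalgebra S \<longleftrightarrow> kmat.subspace S \<and> (\<forall>A\<in>S. \<forall>B\<in>S. comm A B \<in> S)"

text \<open>
  \<open>ad z\<close> acts on the right, sending \<open>w\<close> to the commutator \<open>[w, z]\<close>.  A product of such operators,
  applied from left to right, is therefore a forward composition.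
\<close>

definition ad :: "'k::field_char_0 gmat \<Rightarrow> 'k gmat \<Rightarrow> 'k gmat"
  where "ad z w = comm w z"

notation fcomp (infixl \<open>\<circ>>\<close> 60)

text \<open>
  \<open>M\<close> is a free module over the ring \<open>R\<close> of scalar matrices, acting by matrix multiplication, and
  \<open>B\<close> is a (finite) set of free generators.
\<close>

definition free_module_on ::
    "'k::field_char_0 gmat set \<Rightarrow> 'k gmat set \<Rightarrow> 'k gmat set \<Rightarrow> bool"
  where "free_module_on R M B \<longleftrightarrow>
    0 \<in> M \<and> (\<forall>m\<in>M. \<forall>n\<in>M. m + n \<in> M) \<and> (\<forall>m\<in>M. \<forall>r\<in>R. m ** r \<in> M) \<and>
    finite B \<and> B \<subseteq> M \<and>
    (\<forall>m\<in>M. \<exists>r. (\<forall>b\<in>B. r b \<in> R) \<and> m = (\<Sum>b\<in>B. b ** r b)) \<and>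
    (\<forall>r. (\<forall>b\<in>B. r b \<in> R) \<longrightarrow> (\<Sum>b\<in>B. b ** r b) = 0 \<longrightarrow> (\<forall>b\<in>B. r b = 0))"

end

theory Submission
  imports Defs
begin

text \<open>
  Write \<open>z = [x, y]\<close>, \<open>p = xv - yt\<close>, \<open>q = xu - yv\<close>.  Everything rests on one table of six commutators,
  a consequence of the Cayley--Hamilton identities \<open>2x\<^sup>2 = t\<close>, \<open>2y\<^sup>2 = u\<close>, \<open>xy + yx = v\<close>:
  \<open>[z,x] = 2p\<close>, \<open>[z,y] = 2q\<close>, \<open>[p,x] = tz\<close>, \<open>[p,y] = [q,x] = vz\<close>, \<open>[q,y] = uz\<close>.
  In particular a product of two operators \<open>ad x\<close>, \<open>ad y\<close> multiplies suitable elements among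
  \<open>p, q, z\<close> by \<open>2t\<close>, \<open>2u\<close> or \<open>2v\<close>, and the Lie words of part (ii) are obtained by iterating this.

  Let \<open>R = K[t,u,v]\<close>, \<open>T = xR + yR + zR\<close> and \<open>M = pR + qR + zR\<close>.  The table gives
  \<open>[T, T] \<subseteq> M\<close> (lemma \<open>comm_combinations\<close>) and the definitions of \<open>p\<close> and \<open>q\<close> give \<open>M \<subseteq> T\<close>.  So \<open>T\<close>
  is a Lie algebra containing \<open>x\<close> and \<open>y\<close>, whence \<open>L \<subseteq> T\<close> and \<open>L' \<subseteq> M\<close>.  Conversely, the polynomials
  \<open>f\<close> with \<open>z f \<in> L'\<close> are stable under multiplication by \<open>t\<close>, \<open>u\<close> and \<open>v\<close>, because
  \<open>2 z f t = [z f, x, x]\<close> and similarly for \<open>u\<close> and \<open>v\<close>; hence \<open>z R \<subseteq> L'\<close>, and commuting with \<open>x\<close> and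
  \<open>y\<close> once more gives \<open>p R, q R \<subseteq> L'\<close>.  Thus \<open>L' = M\<close> (lemma \<open>L'_eq\<close>).

  Freeness (lemma \<open>independent\<close>) holds even over the whole polynomial ring.  With respect to the
  trace form \<open>z\<close> is orthogonal to \<open>x\<close> and \<open>y\<close>, hence to \<open>p\<close> and \<open>q\<close>, while
  \<open>tr (z\<^sup>2) = 2 (v\<^sup>2 - tu)\<close>.  So in a relation between \<open>p, q, z\<close> the coefficient of \<open>z\<close> vanishes;
  commuting the rest with \<open>x\<close> and \<open>y\<close> leaves a \<open>2 \<times> 2\<close> linear system of determinant
  \<open>tu - v\<^sup>2\<close>.  This polynomial is nonzero, and the polynomial ring is a domain.
\<close>


section \<open>The polynomial ring is a domain\<close>

text \<open>
  For a linearly ordered set of variables, exponent vectors are linearly ordered lexicographically,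
  and a product of polynomials has the product of the leading terms as its leading term.  Any
  linear order on the six variables serves this purpose.
\<close>

primrec gvar_rank :: "gvar \<Rightarrow> nat" where
  "gvar_rank X11 = 0"
| "gvar_rank X12 = 1"
| "gvar_rank X21 = 2"
| "gvar_rank Y11 = 3"
| "gvar_rank Y12 = 4"
| "gvar_rank Y21 = 5"

lemma gvar_rank_inject: "gvar_rank a = gvar_rank b \<Longrightarrow> a = b"
  by (cases a; cases b) simp_all

instantiation gvar :: linorder
begin

definition less_eq_gvar :: "gvar \<Rightarrow> gvar \<Rightarrow> bool"
  where "a \<le> b \<longleftrightarrow> gvar_rank a \<le> gvar_rank b"

definition less_gvar :: "gvar \<Rightarrow> gvar \<Rightarrow> bool"
  where "a < b \<longleftrightarrow> gvar_rank a < gvar_rank b"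

instance
  by standard (auto simp: less_eq_gvar_def less_gvar_def intro: gvar_rank_inject)

end


section \<open>Scalar matrices and commutators\<close>

text \<open>
  Read entry by entry, an identity between linear combinations of matrices with polynomial
  coefficients becomes an identity in a commutative ring.
\<close>

lemma mult_mat_nth: "(A ** mat f) $ i $ j = A $ i $ j * f"
  for A :: "'a::semiring_1 ^ 'n ^ 'm"
  by (simp add: matrix_matrix_mult_def mat_def if_distrib [where f = "\<lambda>c. _ * c"] cong: if_cong)

lemma mat_mult_commute: "mat f ** A = A ** mat f"
  for A :: "'a::comm_semiring_1 ^ 'n ^ 'n"
  by (simp add: matrix_matrix_mult_def mat_def vec_eq_iff mult_delta_left mult_delta_right mult.commute)

lemma mult_mat_mult_mat: "A ** mat f ** mat g = A ** mat (f * g)"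
  for A :: "'a::comm_semiring_1 ^ 'n ^ 'm"
  by (simp add: vec_eq_iff mult_mat_nth mult.assoc)

lemma trace_mult_mat: "trace (A ** mat f) = trace A * f"
  for A :: "'a::semiring_1 ^ 'n ^ 'n"
  by (simp add: trace_def mult_mat_nth sum_distrib_right)

lemmas mat2_eq_iff = vec_eq_iff forall_2
lemmas mat2_mult = matrix_matrix_mult_def sum_2

lemma kscale_eq: "kscale c A = A ** mat (Const c)"
  by (simp add: kscale_def mat_mult_commute)

lemma numeral_eq_Const: "numeral n = Const (numeral n)"
  by (simp add: Const_def)

text \<open>
  The table of commutators yields elements of \<open>L'\<close> only up to a factor two, which can be cancelled
  inside a subspace because the characteristic is zero.
\<close>
lemma mult_mat_numeral_mem:
  assumes "kmat.subspace S" and "A ** mat (numeral n) \<in> S"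
  shows "A \<in> S"
proof -
  have "kscale (1 / numeral n) (A ** mat (numeral n)) = A"
    unfolding kscale_eq mult_mat_mult_mat numeral_eq_Const by (simp add: Const_def mult_single del: single_numeral)
  then show ?thesis
    using kmat.subspace_scale [OF assms, of "1 / numeral n"] by simp
qed

lemma comm_mult_mat: "comm (A ** mat f) (B ** mat g) = comm A B ** mat (f * g)"
  by (simp add: comm_def mat2_eq_iff mat2_mult mat_def algebra_simps)

lemma comm_mult_mat_left: "comm (A ** mat f) B = comm A B ** mat f"
  using comm_mult_mat [of A f B 1] by simp

lemma comm_add_left: "comm (A + B) C = comm A C + comm B C"
  and comm_add_right: "comm C (A + B) = comm C A + comm C B"
  and comm_diff_left: "comm (A - B) C = comm A C - comm B C"
  and comm_self: "comm A A = 0"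
  and comm_0_left: "comm 0 A = 0"
  and comm_minus_left: "comm (- A) B = - comm A B"
  and comm_antisym: "comm B A = - comm A B"
  by (simp_all add: comm_def mat2_eq_iff mat2_mult algebra_simps)

text \<open>
  Equivalent to the Cayley--Hamilton theorem for \<open>2 \<times> 2\<close> matrices: with \<open>2A\<^sup>2 = tr (A\<^sup>2)\<close> and
  \<open>AB + BA = tr (AB)\<close> one has \<open>[A,B,A] = 2ABA - (A\<^sup>2B + BA\<^sup>2)\<close> and \<open>ABA = A tr (AB) - A\<^sup>2B\<close>.
\<close>
lemma comm_comm_traceless:
  assumes "trace A = 0" and "trace B = 0"
  shows "comm (comm A B) A = (A ** mat (trace (A ** B)) - B ** mat (trace (A ** A))) ** mat 2"
proof -
  have [simp]: "A $ 2 $ 2 = - A $ 1 $ 1" "B $ 2 $ 2 = - B $ 1 $ 1"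
    using assms by (simp_all add: trace_def sum_2 eq_neg_iff_add_eq_0 add.commute)
  show ?thesis
    by (simp add: mat2_eq_iff mult_mat_nth)
       (simp add: comm_def trace_def mat2_mult algebra_simps)
qed

text \<open>
  Up to the factor \<open>-2\<close>, this is the Gram determinant of \<open>A, B\<close> for the trace form.
\<close>
lemma trace_square_comm_traceless:
  assumes "trace A = 0" and "trace B = 0"
  shows "trace (comm A B ** comm A B) =
    2 * (trace (A ** B) * trace (A ** B) - trace (A ** A) * trace (B ** B))"
proof -
  have [simp]: "A $ 2 $ 2 = - A $ 1 $ 1" "B $ 2 $ 2 = - B $ 1 $ 1"
    using assms by (simp_all add: trace_def sum_2 eq_neg_iff_add_eq_0 add.commute)
  show ?thesis
    by (simp add: comm_def trace_def mat2_mult algebra_simps)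
qed

lemma funpow_mult_mat:
  assumes "\<And>f. F (A ** mat f) = A ** mat (g * f)"
  shows "(F ^^ n) (A ** mat f) = A ** mat (g ^ n * f)"
  by (induction n) (simp_all add: assms mult.assoc)


section \<open>Generated subalgebras\<close>

lemma subalgebra_Inter: "(\<And>S. S \<in> F \<Longrightarrow> subalgebra S) \<Longrightarrow> subalgebra (\<Inter>F)"
  unfolding subalgebra_def by (auto intro: kmat.subspace_Inter)

lemma lie_subalgebra_Inter: "(\<And>S. S \<in> F \<Longrightarrow> lie_subalgebra S) \<Longrightarrow> lie_subalgebra (\<Inter>F)"
  unfolding lie_subalgebra_def by (auto intro: kmat.subspace_Inter)

lemma subalgebra_hull: "subalgebra (subalgebra hull S)"
  by (rule hull_in) (blast intro: subalgebra_Inter)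

lemma subalgebra_imp_lie_subalgebra: "subalgebra S \<Longrightarrow> lie_subalgebra S"
  unfolding subalgebra_def lie_subalgebra_def comm_def by (blast intro: kmat.subspace_diff)

lemma subalgebra_scalars: "subalgebra (range mat)"
  unfolding subalgebra_def kmat.subspace_def
  by (auto simp: kscale_def simp flip: mat_add mat_mult mat_0)


section \<open>The table of commutators\<close>

text \<open>
  All but the freeness of \<open>L'\<close> holds for an arbitrary pair of traceless matrices; the freeness needs
  in addition that \<open>v\<^sup>2 \<noteq> tu\<close>.
\<close>

locale traceless_pair =
  fixes x y :: "'k::field_char_0 gmat" and t u v :: "'k gpoly" and p q z :: "'k gmat"
    and W L L' Ktuv :: "'k gmat set"
  assumes trace_x: "trace x = 0" and trace_y: "trace y = 0"
    and t: "t = trace (x ** x)" and u: "u = trace (y ** y)" and v: "v = trace (x ** y)"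
    and p: "p = x ** mat v - y ** mat t" and q: "q = x ** mat u - y ** mat v"
    and z: "z = comm x y"
    and W: "W = subalgebra hull {x, y}"
    and L: "L = (\<lambda>S. S \<subseteq> W \<and> lie_subalgebra S) hull {x, y}"
    and L': "L' = kmat.span {comm z1 z2 | z1 z2. z1 \<in> L \<and> z2 \<in> L}"
    and Ktuv: "Ktuv = subalgebra hull {mat t, mat u, mat v}"
begin

lemma comm_z_x: "comm z x = p ** mat 2"
  by (simp add: z p t v comm_comm_traceless trace_x trace_y)

lemma comm_z_y: "comm z y = q ** mat 2"
proof -
  have "comm z y = - comm (comm y x) y"
    unfolding z by (simp add: comm_antisym [of x y] comm_minus_left)
  then show ?thesis
    by (simp add: comm_comm_traceless trace_x trace_y q u v trace_mul_sym [of y x])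
       (simp add: vec_eq_iff mult_mat_nth algebra_simps)
qed

lemma comm_p_x: "comm p x = z ** mat t" and comm_p_y: "comm p y = z ** mat v"
  and comm_q_x: "comm q x = z ** mat v" and comm_q_y: "comm q y = z ** mat u"
  by (simp_all add: p q z comm_diff_left comm_mult_mat_left comm_self comm_antisym [of y x])
     (simp_all add: vec_eq_iff mult_mat_nth)

lemmas comm_gens = comm_z_x comm_z_y comm_p_x comm_p_y comm_q_x comm_q_y


section \<open>Lie words\<close>

text \<open>
  Each of these eigenvector relations reflects a path of length two through the table that returns to
  its starting point, such as \<open>z \<mapsto> 2p \<mapsto> 2vz\<close> for the eigenvector \<open>z\<close> of \<open>ad x ad y\<close>.
\<close>
lemma funpow_ad2:
  "((ad x \<circ>> ad x) ^^ n) (z ** mat f) = z ** mat ((2 * t) ^ n * f)"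
  "((ad x \<circ>> ad x) ^^ n) (p ** mat f) = p ** mat ((2 * t) ^ n * f)"
  "((ad y \<circ>> ad y) ^^ n) (z ** mat f) = z ** mat ((2 * u) ^ n * f)"
  "((ad y \<circ>> ad y) ^^ n) (q ** mat f) = q ** mat ((2 * u) ^ n * f)"
  "((ad x \<circ>> ad y) ^^ n) (z ** mat f) = z ** mat ((2 * v) ^ n * f)"
  "((ad x \<circ>> ad y) ^^ n) (q ** mat f) = q ** mat ((2 * v) ^ n * f)"
  "((ad y \<circ>> ad x) ^^ n) (p ** mat f) = p ** mat ((2 * v) ^ n * f)"
  by (rule funpow_mult_mat; simp add: ad_def fcomp_def comm_mult_mat_left comm_gens mult_mat_mult_mat ac_simps)+

lemma funpow_even: "(F ^^ (2 * n)) = ((F \<circ>> F) ^^ n)"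
  by (induction n) (simp_all add: fcomp_comp o_assoc)

lemma ad_mult_mat:
  "ad x (z ** mat f) = p ** mat (2 * f)" "ad y (z ** mat f) = q ** mat (2 * f)"
  "ad x (p ** mat f) = z ** mat (t * f)" "ad y (p ** mat f) = z ** mat (v * f)"
  "ad x (q ** mat f) = z ** mat (v * f)" "ad y (q ** mat f) = z ** mat (u * f)"
  by (simp_all add: ad_def comm_mult_mat_left comm_gens mult_mat_mult_mat)

lemma mat_mult_gens:
  "mat f ** p = p ** mat f" "mat f ** q = q ** mat f" "mat f ** z = z ** mat f"
  by (rule mat_mult_commute)+

lemmas word_simps = funpow_even funpow_ad2 ad_mult_mat mat_mult_gens
  mult_mat_mult_mat power_mult_distrib power_add

text \<open>
  The word starts at \<open>[z, y] = 2q\<close>.  An odd number of operators \<open>ad y\<close> leads from \<open>q\<close> to \<open>z\<close>, an odd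
  number of operators \<open>ad x\<close> from \<open>z\<close> to \<open>p\<close>, and \<open>ad y ad x\<close> fixes \<open>p\<close> up to \<open>2v\<close>.
\<close>
lemma p_word:
  assumes "b > 0"
  shows "mat (2 ^ (a + b + c + 1)) ** p ** mat (t ^ a * u ^ b * v ^ c) =
    ((ad y ^^ (2 * b - 1)) \<circ>> (ad x ^^ (2 * a + 1)) \<circ>> ((ad y \<circ>> ad x) ^^ c)) (comm z y)"
proof -
  obtain b' where b: "b = Suc b'" using assms by (cases b) auto
  then have "2 * b - 1 = Suc (2 * b')" by simp
  with b show ?thesis
    by (simp add: word_simps comm_z_y) (simp add: ac_simps)
qed

text \<open>
  Without a factor \<open>u\<close> there is no room for the detour from \<open>q\<close> to \<open>z\<close>, so the word starts at
  \<open>[z, x] = 2p\<close> and stays in \<open>pR\<close> between the pairs of operators.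
\<close>
lemma p_word_without_u:
  "mat (2 ^ (a + c + 1)) ** p ** mat (t ^ a * v ^ c) =
    ((ad x ^^ (2 * a)) \<circ>> ((ad y \<circ>> ad x) ^^ c)) (comm z x)"
  by (simp add: word_simps comm_z_x) (simp add: ac_simps)

text \<open>
  The mirror image of \<open>p_word\<close>: the path is now \<open>2p\<close>, \<open>z\<close>, \<open>q\<close>.
\<close>
lemma q_word:
  assumes "a > 0"
  shows "mat (2 ^ (a + b + c + 1)) ** q ** mat (t ^ a * u ^ b * v ^ c) =
    ((ad x ^^ (2 * a - 1)) \<circ>> (ad y ^^ (2 * b + 1)) \<circ>> ((ad x \<circ>> ad y) ^^ c)) (comm z x)"
proof -
  obtain a' where a: "a = Suc a'" using assms by (cases a) auto
  then have "2 * a - 1 = Suc (2 * a')" by simp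
  with a show ?thesis
    by (simp add: word_simps comm_z_x) (simp add: ac_simps)
qed

lemma q_word_without_t:
  "mat (2 ^ (b + c + 1)) ** q ** mat (u ^ b * v ^ c) =
    ((ad y ^^ (2 * b)) \<circ>> ((ad x \<circ>> ad y) ^^ c)) (comm z y)"
  by (simp add: word_simps comm_z_y) (simp add: ac_simps)

lemma z_word:
  "mat (2 ^ (a + b + c)) ** z ** mat (t ^ a * u ^ b * v ^ c) =
    ((ad x ^^ (2 * a)) \<circ>> (ad y ^^ (2 * b)) \<circ>> ((ad x \<circ>> ad y) ^^ c)) z"
  by (simp add: word_simps funpow_ad2(1) [where f = 1, simplified]) (simp add: ac_simps)


section \<open>The commutator ideal is contained in the module\<close>

lemma subalgebra_Ktuv: "subalgebra Ktuv"
  unfolding Ktuv by (rule subalgebra_hull)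

lemma Ktuv_scalar: "r \<in> Ktuv \<Longrightarrow> \<exists>f. r = mat f"
  using hull_minimal [where S = subalgebra and s = "{mat t, mat u, mat v}" and t = "range mat"]
    subalgebra_scalars unfolding Ktuv by auto

lemma mat_mem_Ktuv:
  shows "mat t \<in> Ktuv" "mat u \<in> Ktuv" "mat v \<in> Ktuv" "mat 1 \<in> Ktuv" "0 \<in> Ktuv"
    and "mat f \<in> Ktuv \<Longrightarrow> mat g \<in> Ktuv \<Longrightarrow> mat (f + g) \<in> Ktuv"
    and "mat f \<in> Ktuv \<Longrightarrow> mat g \<in> Ktuv \<Longrightarrow> mat (f - g) \<in> Ktuv"
    and "mat f \<in> Ktuv \<Longrightarrow> mat g \<in> Ktuv \<Longrightarrow> mat (f * g) \<in> Ktuv"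
    and "mat f \<in> Ktuv \<Longrightarrow> mat (- f) \<in> Ktuv"
    and "mat (Const c) \<in> Ktuv" and "mat (numeral n) \<in> Ktuv"
proof -
  have K: "kmat.subspace Ktuv" "mat 1 \<in> Ktuv" "\<And>A B. A \<in> Ktuv \<Longrightarrow> B \<in> Ktuv \<Longrightarrow> A ** B \<in> Ktuv"
    using subalgebra_Ktuv by (auto simp: subalgebra_def)
  show "mat t \<in> Ktuv" "mat u \<in> Ktuv" "mat v \<in> Ktuv" "mat 1 \<in> Ktuv" "0 \<in> Ktuv"
    using kmat.subspace_0 [OF K(1)] K(2) by (auto simp: Ktuv hull_inc)
  have diff: "mat (f - g) = mat f - (mat g :: 'k gmat)" for f g :: "'k gpoly"
    by (simp add: mat_def vec_eq_iff)
  then show "mat f \<in> Ktuv \<Longrightarrow> mat (- f) \<in> Ktuv"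
    using kmat.subspace_diff [OF K(1) kmat.subspace_0 [OF K(1)]] by (metis diff_0 mat_0)
  show "mat f \<in> Ktuv \<Longrightarrow> mat g \<in> Ktuv \<Longrightarrow> mat (f + g) \<in> Ktuv"
    "mat f \<in> Ktuv \<Longrightarrow> mat g \<in> Ktuv \<Longrightarrow> mat (f - g) \<in> Ktuv"
    "mat f \<in> Ktuv \<Longrightarrow> mat g \<in> Ktuv \<Longrightarrow> mat (f * g) \<in> Ktuv"
    by (simp_all add: mat_add diff mat_mult K kmat.subspace_add kmat.subspace_diff)
  show const: "mat (Const c) \<in> Ktuv" for c
    using kmat.subspace_scale [OF K(1,2), of c] by (simp add: kscale_def)
  show "mat (numeral n) \<in> Ktuv"
    using const [of "numeral n"] by (simp add: numeral_eq_Const)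
qed

definition combinations :: "'k gmat \<Rightarrow> 'k gmat \<Rightarrow> 'k gmat \<Rightarrow> 'k gmat set" where
  "combinations A B C = {A ** mat f + B ** mat g + C ** mat h | f g h.
    mat f \<in> Ktuv \<and> mat g \<in> Ktuv \<and> mat h \<in> Ktuv}"

lemma combinationsI:
  assumes "m = A ** mat f + B ** mat g + C ** mat h"
    and "mat f \<in> Ktuv" "mat g \<in> Ktuv" "mat h \<in> Ktuv"
  shows "m \<in> combinations A B C"
  using assms unfolding combinations_def by blast

lemma combinationsE:
  assumes "m \<in> combinations A B C"
  obtains f g h where "m = A ** mat f + B ** mat g + C ** mat h"
    "mat f \<in> Ktuv" "mat g \<in> Ktuv" "mat h \<in> Ktuv"
  using assms unfolding combinations_def by blast

lemma subspace_combinations: "kmat.subspace (combinations A B C)"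
proof (rule kmat.subspaceI)
  show "0 \<in> combinations A B C"
    by (rule combinationsI [of _ _ 0 _ 0 _ 0]) (simp_all add: mat_mem_Ktuv vec_eq_iff mult_mat_nth)
next
  fix m n assume "m \<in> combinations A B C" "n \<in> combinations A B C"
  then obtain f g h f' g' h' where
    "m = A ** mat f + B ** mat g + C ** mat h" "mat f \<in> Ktuv" "mat g \<in> Ktuv" "mat h \<in> Ktuv"
    "n = A ** mat f' + B ** mat g' + C ** mat h'" "mat f' \<in> Ktuv" "mat g' \<in> Ktuv" "mat h' \<in> Ktuv"
    by (meson combinationsE)
  then show "m + n \<in> combinations A B C"
    by (intro combinationsI [of _ _ "f + f'" _ "g + g'" _ "h + h'"])
       (simp_all add: mat_mem_Ktuv vec_eq_iff mult_mat_nth algebra_simps)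
next
  fix c m assume "m \<in> combinations A B C"
  then obtain f g h where
    "m = A ** mat f + B ** mat g + C ** mat h" "mat f \<in> Ktuv" "mat g \<in> Ktuv" "mat h \<in> Ktuv"
    by (rule combinationsE)
  then show "kscale c m \<in> combinations A B C"
    by (intro combinationsI [of _ _ "f * Const c" _ "g * Const c" _ "h * Const c"])
       (simp_all add: mat_mem_Ktuv kscale_eq vec_eq_iff mult_mat_nth algebra_simps)
qed

text \<open>
  The cross product in the coordinates \<open>x, y, z\<close>.  The point is that neither \<open>x\<close> nor \<open>y\<close>, but only
  \<open>p, q, z\<close>, occurs on the right.
\<close>
lemma comm_combinations:
  "comm (x ** mat f + y ** mat g + z ** mat h) (x ** mat f' + y ** mat g' + z ** mat h') =
    p ** mat (2 * (h * f' - f * h')) + q ** mat (2 * (h * g' - g * h')) + z ** mat (f * g' - g * f')"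
  by (simp add: comm_add_left comm_add_right comm_mult_mat comm_self comm_antisym [of x z]
        comm_antisym [of y z] comm_antisym [of y x] comm_z_x comm_z_y flip: z)
     (simp add: vec_eq_iff mult_mat_nth algebra_simps)

lemma comm_combinations_mem:
  assumes "m \<in> combinations x y z" and "n \<in> combinations x y z"
  shows "comm m n \<in> combinations p q z"
proof -
  obtain f g h where
    m: "m = x ** mat f + y ** mat g + z ** mat h" "mat f \<in> Ktuv" "mat g \<in> Ktuv" "mat h \<in> Ktuv"
    using assms(1) by (rule combinationsE)
  obtain f' g' h' where
    n: "n = x ** mat f' + y ** mat g' + z ** mat h'" "mat f' \<in> Ktuv" "mat g' \<in> Ktuv" "mat h' \<in> Ktuv"
    using assms(2) by (rule combinationsE)
  show ?thesis
    by (rule combinationsI [OF comm_combinations [of f g h f' g' h', folded m(1) n(1)]])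
       (simp_all add: mat_mem_Ktuv m n)
qed

lemma combinations_pqz_subset: "combinations p q z \<subseteq> combinations x y z"
proof
  fix m assume "m \<in> combinations p q z"
  then obtain f g h where
    "m = p ** mat f + q ** mat g + z ** mat h" "mat f \<in> Ktuv" "mat g \<in> Ktuv" "mat h \<in> Ktuv"
    by (rule combinationsE)
  then show "m \<in> combinations x y z"
    by (intro combinationsI [of _ _ "v * f + u * g" _ "- (t * f + v * g)" _ h])
       (simp add: p q vec_eq_iff mult_mat_nth algebra_simps, (blast intro: mat_mem_Ktuv)+)
qed

lemma lie_subalgebra_L: "lie_subalgebra L" and x_L: "x \<in> L" and y_L: "y \<in> L"
  unfolding L hull_def by (auto intro: lie_subalgebra_Inter)

text \<open>
  By \<open>comm_combinations_mem\<close> and \<open>combinations_pqz_subset\<close>, the module \<open>xR + yR + zR\<close> is closed under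
  commutators.  The intersection with
  \<open>W\<close> makes it one of the Lie subalgebras of \<open>W\<close> over which \<open>L\<close> is minimal.
\<close>
lemma L_subset: "L \<subseteq> combinations x y z"
proof -
  have "lie_subalgebra (combinations x y z)"
    unfolding lie_subalgebra_def
    using subspace_combinations comm_combinations_mem combinations_pqz_subset by blast
  moreover have "lie_subalgebra W"
    unfolding W by (intro subalgebra_imp_lie_subalgebra subalgebra_hull)
  ultimately have "lie_subalgebra (combinations x y z \<inter> W)"
    unfolding lie_subalgebra_def by (auto intro: kmat.subspace_inter)
  moreover have "x \<in> combinations x y z" "y \<in> combinations x y z"
    by (rule combinationsI [of _ _ 1 _ 0 _ 0], simp_all add: mat_mem_Ktuv vec_eq_iff mult_mat_nth)
       (rule combinationsI [of _ _ 0 _ 1 _ 0], simp_all add: mat_mem_Ktuv vec_eq_iff mult_mat_nth)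
  moreover have "x \<in> W" "y \<in> W"
    by (simp_all add: W hull_inc)
  ultimately have "L \<subseteq> combinations x y z \<inter> W"
    unfolding L by (intro hull_minimal) auto
  then show ?thesis by blast
qed

lemma L'_subset: "L' \<subseteq> combinations p q z"
  unfolding L' using L_subset
  by (intro kmat.span_minimal subspace_combinations) (blast intro: comm_combinations_mem)


section \<open>The module is contained in the commutator ideal\<close>

lemma comm_mem_L': "m \<in> L \<Longrightarrow> n \<in> L \<Longrightarrow> comm m n \<in> L'"
  unfolding L' by (blast intro: kmat.span_base)

lemma subspace_L': "kmat.subspace L'"
  unfolding L' by simp

lemma L'_subset_L: "L' \<subseteq> L"
  unfolding L' using lie_subalgebra_L by (intro kmat.span_minimal) (auto simp: lie_subalgebra_def)

lemma comm_xy_mem_L': "m \<in> L' \<Longrightarrow> comm m x \<in> L'" "m \<in> L' \<Longrightarrow> comm m y \<in> L'"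
  using L'_subset_L comm_mem_L' x_L y_L by blast+

lemma pq_mem_L':
  assumes "z ** mat f \<in> L'"
  shows "p ** mat f \<in> L'" and "q ** mat f \<in> L'"
proof -
  have "p ** mat f ** mat 2 \<in> L'" "q ** mat f ** mat 2 \<in> L'"
    using assms [THEN comm_xy_mem_L'(1)] assms [THEN comm_xy_mem_L'(2)]
    by (simp_all add: comm_mult_mat_left comm_z_x comm_z_y mult_mat_mult_mat mult.commute)
  then show "p ** mat f \<in> L'" "q ** mat f \<in> L'"
    by (auto dest: mult_mat_numeral_mem [OF subspace_L'])
qed

text \<open>
  The steps that multiply \<open>z f\<close> by a generator of \<open>R\<close>, each a path of length two from \<open>z\<close> back to \<open>z\<close>
  in the table: through \<open>p\<close> for \<open>t\<close> and \<open>v\<close>, and through \<open>q\<close> for \<open>u\<close>.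
\<close>
lemma z_mult_tuv_mem_L':
  assumes "z ** mat f \<in> L'"
  shows "z ** mat f ** mat t \<in> L'" "z ** mat f ** mat u \<in> L'" "z ** mat f ** mat v \<in> L'"
  using pq_mem_L'(1) [OF assms, THEN comm_xy_mem_L'(1)]
    pq_mem_L'(2) [OF assms, THEN comm_xy_mem_L'(2)]
    pq_mem_L'(1) [OF assms, THEN comm_xy_mem_L'(2)]
  by (simp_all add: comm_mult_mat_left comm_gens mult_mat_mult_mat mult.commute)

text \<open>
  The scalars that preserve \<open>{f. z f \<in> L'}\<close> under multiplication form a subalgebra, so it suffices to
  know that \<open>t, u, v\<close> are among them.  The set \<open>{f. z f \<in> L'}\<close> itself is not visibly closed under
  products, which is why its multipliers are considered instead.
\<close>
lemma z_mult_mem_L':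
  assumes "r \<in> Ktuv"
  shows "z ** r \<in> L'"
proof -
  define S :: "'k gmat set" where "S = {mat g | g. \<forall>f. z ** mat f \<in> L' \<longrightarrow> z ** mat (f * g) \<in> L'}"
  have "subalgebra S"
    unfolding subalgebra_def
  proof (intro conjI kmat.subspaceI ballI)
    show "0 \<in> S"
      unfolding S_def mem_Collect_eq by (rule exI [of _ 0]) (simp add: kmat.subspace_0 [OF subspace_L'])
    show "mat 1 \<in> S"
      unfolding S_def mem_Collect_eq by (rule exI [of _ 1]) simp
  next
    fix A B assume "A \<in> S" "B \<in> S"
    then obtain g h where gh: "A = mat g" "B = mat h"
      "\<And>f. z ** mat f \<in> L' \<Longrightarrow> z ** mat (f * g) \<in> L'" "\<And>f. z ** mat f \<in> L' \<Longrightarrow> z ** mat (f * h) \<in> L'"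
      unfolding S_def by blast
    have "z ** mat (f * (g + h)) \<in> L'" if "z ** mat f \<in> L'" for f
      using kmat.subspace_add [OF subspace_L' gh(3,4) [OF that]]
      by (simp add: distrib_left mat_add matrix_add_ldistrib)
    then show "A + B \<in> S"
      unfolding S_def gh(1,2) mem_Collect_eq by (intro exI [of _ "g + h"]) (simp add: mat_add)
    have "z ** mat (f * (g * h)) \<in> L'" if "z ** mat f \<in> L'" for f
      using gh(4) [OF gh(3) [OF that]] by (simp add: mult.assoc)
    then show "A ** B \<in> S"
      unfolding S_def gh(1,2) mem_Collect_eq by (intro exI [of _ "g * h"]) (simp add: mat_mult)
  next
    fix c A assume "A \<in> S"
    then obtain g where g: "A = mat g" "\<And>f. z ** mat f \<in> L' \<Longrightarrow> z ** mat (f * g) \<in> L'"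
      unfolding S_def by blast
    have "z ** mat (f * (Const c * g)) \<in> L'" if "z ** mat f \<in> L'" for f
      using kmat.subspace_scale [OF subspace_L' g(2) [OF that], of c]
      by (simp add: kscale_eq mult_mat_mult_mat ac_simps)
    then show "kscale c A \<in> S"
      unfolding S_def g(1) mem_Collect_eq by (intro exI [of _ "Const c * g"]) (simp add: kscale_def mat_mult)
  qed
  moreover have "{mat t, mat u, mat v} \<subseteq> S"
    using z_mult_tuv_mem_L' by (auto simp: S_def mult_mat_mult_mat)
  ultimately have "Ktuv \<subseteq> S"
    unfolding Ktuv by (intro hull_minimal)
  then obtain g where "r = mat g" "\<And>f. z ** mat f \<in> L' \<Longrightarrow> z ** mat (f * g) \<in> L'"
    using assms unfolding S_def by blast
  moreover have "z ** mat 1 \<in> L'"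
    by (simp add: z comm_mem_L' x_L y_L)
  ultimately show ?thesis
    by (metis mult_1)
qed

lemma L'_eq: "L' = combinations p q z"
proof (rule antisym [OF L'_subset subsetI])
  fix m assume "m \<in> combinations p q z"
  then show "m \<in> L'"
    by (elim combinationsE)
       (simp add: z_mult_mem_L' pq_mem_L' kmat.subspace_add [OF subspace_L'])
qed


section \<open>Freeness\<close>

lemma independent:
  assumes nz: "v * v \<noteq> t * u" and eq: "p ** mat f + q ** mat g + z ** mat h = 0"
  shows "f = 0" "g = 0" "h = 0"
proof -
  \<comment> \<open>Pairing the relation with \<open>z\<close> under the trace form isolates the coefficient of \<open>z\<close>.\<close>
  have tr: "trace (z ** z) = 2 * (v * v - t * u)"
    by (simp add: z t u v trace_square_comm_traceless trace_x trace_y)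
  have orth: "trace (z ** x) = 0" "trace (z ** y) = 0"
    by (simp_all add: z comm_def trace_def mat2_mult algebra_simps)
  have "trace (z ** (p ** mat f + q ** mat g + z ** mat h)) =
      trace (z ** x) * (v * f + u * g) - trace (z ** y) * (t * f + v * g) + trace (z ** z) * h"
    by (simp add: p q trace_def mat2_mult mat_def algebra_simps)
  then have "2 * (v * v - t * u) * h = 0"
    by (simp add: eq orth tr) (simp add: trace_def)
  then show h: "h = 0"
    using nz by simp
  have z_nz: "z ** mat k = 0 \<Longrightarrow> k = 0" for k
  proof -
    assume "z ** mat k = 0"
    then have "trace (z ** z ** mat k) = 0"
      by (simp add: matrix_mul_assoc [symmetric]) (simp add: trace_def)
    then have "trace (z ** z) * k = 0"
      by (simp add: trace_mult_mat)
    then show "k = 0"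
      using nz by (simp add: tr)
  qed
  \<comment> \<open>By the table, commuting with \<open>x\<close> and \<open>y\<close> turns the remaining relation into multiples of \<open>z\<close>.\<close>
  have "comm (p ** mat f + q ** mat g) x = 0" "comm (p ** mat f + q ** mat g) y = 0"
    using eq h by (simp_all add: comm_0_left)
  then have "z ** mat (t * f + v * g) = 0" "z ** mat (v * f + u * g) = 0"
    by (simp_all add: comm_add_left comm_mult_mat_left comm_gens mult_mat_mult_mat mat_add matrix_add_ldistrib)
  then have tv: "t * f + v * g = 0" and vu: "v * f + u * g = 0"
    by (auto dest: z_nz)
  \<comment> \<open>Cramer's rule for the two linear equations in \<open>f\<close> and \<open>g\<close>.\<close>
  have "(v * v - t * u) * f = v * (v * f + u * g) - u * (t * f + v * g)"
    "(v * v - t * u) * g = v * (t * f + v * g) - t * (v * f + u * g)"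
    by (simp_all add: algebra_simps)
  then have "(v * v - t * u) * f = 0" "(v * v - t * u) * g = 0"
    unfolding tv vu by simp_all
  then show "f = 0" "g = 0"
    using nz by simp_all
qed

lemma distinct_gens:
  assumes "v * v \<noteq> t * u"
  shows "p \<noteq> q" "p \<noteq> z" "q \<noteq> z"
  using independent(1) [OF assms, of 1 "-1" 0] independent(1) [OF assms, of 1 0 "-1"]
    independent(2) [OF assms, of 0 1 "-1"]
  by (auto simp: vec_eq_iff mult_mat_nth)

lemma free_module:
  assumes nz: "v * v \<noteq> t * u"
  shows "free_module_on Ktuv L' {p, q, z}"
proof -
  note distinct = distinct_gens [OF nz]
  have sum: "(\<Sum>b\<in>{p, q, z}. b ** r b) = p ** r p + q ** r q + z ** r z" for r
    using distinct by (simp add: add.assoc)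
  have mult: "m ** r \<in> L'" if "m \<in> L'" "r \<in> Ktuv" for m r
  proof -
    obtain k where k: "r = mat k" using Ktuv_scalar \<open>r \<in> Ktuv\<close> by blast
    obtain f g h where
      "m = p ** mat f + q ** mat g + z ** mat h" "mat f \<in> Ktuv" "mat g \<in> Ktuv" "mat h \<in> Ktuv"
      using \<open>m \<in> L'\<close> unfolding L'_eq by (rule combinationsE)
    moreover have "mat k \<in> Ktuv" using \<open>r \<in> Ktuv\<close> k by simp
    ultimately show ?thesis
      unfolding L'_eq k by (intro combinationsI [of _ _ "f * k" _ "g * k" _ "h * k"])
       (simp_all add: mat_mem_Ktuv vec_eq_iff mult_mat_nth algebra_simps)
  qed
  have gens: "{p, q, z} \<subseteq> L'"
    using z_mult_mem_L' [OF mat_mem_Ktuv(4)] pq_mem_L' [of 1] by simp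
  have spans: "\<exists>r. (\<forall>b\<in>{p, q, z}. r b \<in> Ktuv) \<and> m = (\<Sum>b\<in>{p, q, z}. b ** r b)" if "m \<in> L'" for m
  proof -
    obtain f g h where
      "m = p ** mat f + q ** mat g + z ** mat h" "mat f \<in> Ktuv" "mat g \<in> Ktuv" "mat h \<in> Ktuv"
      using \<open>m \<in> L'\<close> unfolding L'_eq by (rule combinationsE)
    with distinct show ?thesis
      unfolding sum
      by (intro exI [of _ "\<lambda>b. if b = p then mat f else if b = q then mat g else mat h"]) auto
  qed
  have indep: "\<forall>b\<in>{p, q, z}. r b = 0"
    if r: "\<forall>b\<in>{p, q, z}. r b \<in> Ktuv" "(\<Sum>b\<in>{p, q, z}. b ** r b) = 0" for r
  proof -
    obtain f g h where "r p = mat f" "r q = mat g" "r z = mat h"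
      using r(1) Ktuv_scalar [of "r p"] Ktuv_scalar [of "r q"] Ktuv_scalar [of "r z"] by auto
    with r(2) independent [OF nz, of f g h] show ?thesis
      unfolding sum by simp
  qed
  show ?thesis
    unfolding free_module_on_def
  proof (intro conjI ballI allI impI)
    show "0 \<in> L'" by (rule kmat.subspace_0 [OF subspace_L'])
    show "m + n \<in> L'" if "m \<in> L'" "n \<in> L'" for m n
      using that by (rule kmat.subspace_add [OF subspace_L'])
    show "r b = 0" if "\<forall>b\<in>{p, q, z}. r b \<in> Ktuv" "(\<Sum>b\<in>{p, q, z}. b ** r b) = 0"
      "b \<in> {p, q, z}" for r b
      using indep [OF that(1,2)] that(3) by (rule bspec)
  qed (fact mult spans gens finite.intros | simp)+
qed

end


section \<open>The generic matrices\<close>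

lemma all_gvar: "(\<forall>g. P g) \<longleftrightarrow> P X11 \<and> P X12 \<and> P X21 \<and> P Y11 \<and> P Y12 \<and> P Y21"
  by (metis gvar.exhaust)

text \<open>
  The monomial \<open>x\<^sub>1\<^sub>2\<^sup>2 y\<^sub>2\<^sub>1\<^sup>2\<close> has coefficient \<open>1\<close> in \<open>v\<^sup>2\<close>, and does not occur in \<open>tu\<close>, where every
  monomial that contains \<open>x\<^sub>1\<^sub>2\<close> also contains \<open>x\<^sub>2\<^sub>1\<close>.
\<close>
lemma generic_discriminant:
  defines "x \<equiv> generic_x :: 'k::field_char_0 gmat" and "y \<equiv> generic_y"
  shows "trace (x ** y) * trace (x ** y) \<noteq> trace (x ** x) * trace (y ** y)"
proof -
  define k :: "gvar \<Rightarrow>\<^sub>0 nat" where "k = Poly_Mapping.single X12 2 + Poly_Mapping.single Y21 2"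
  have *: "trace (x ** y) * trace (x ** y) - trace (x ** x) * trace (y ** y) =
     Var X12 * Var Y21 * Var X12 * Var Y21
   + Var X21 * Var Y12 * Var X21 * Var Y12 - 2 * Var X12 * Var Y21 * Var X21 * Var Y12
   + 4 * Var X11 * Var Y11 * Var X12 * Var Y21 + 4 * Var X11 * Var Y11 * Var X21 * Var Y12
   - 4 * Var X11 * Var X11 * Var Y12 * Var Y21 - 4 * Var Y11 * Var Y11 * Var X12 * Var X21"
    by (simp add: x_def y_def generic_x_def generic_y_def trace_def mat2_mult algebra_simps)
  have "Poly_Mapping.lookup (trace (x ** y) * trace (x ** y) - trace (x ** x) * trace (y ** y)) k = 1"
    unfolding * numeral_eq_Const Const_def Var_def mult_single lookup_add lookup_minus lookup_single when_def
      poly_mapping_eq_iff fun_eq_iff all_gvar k_def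
    by (simp add: lookup_add lookup_single)
  then show ?thesis by auto
qed

theorem lemma2:
  fixes x y :: "'k::field_char_0 gmat"
    and t u v :: "'k gpoly"
    and W L L' Ktuv :: "'k gmat set"
  assumes "x = generic_x" and "y = generic_y"
    and "t = trace (x ** x)" and "u = trace (y ** y)" and "v = trace (x ** y)"
    and "W = subalgebra hull {x, y}"
    and "L = (\<lambda>S. S \<subseteq> W \<and> lie_subalgebra S) hull {x, y}"
    and "L' = kmat.span {comm z1 z2 | z1 z2. z1 \<in> L \<and> z2 \<in> L}"
    and "Ktuv = subalgebra hull {mat t, mat u, mat v}"
  shows
    "free_module_on Ktuv L'
       {x ** mat v - y ** mat t, x ** mat u - y ** mat v, comm x y} \<and>
     card {x ** mat v - y ** mat t, x ** mat u - y ** mat v, comm x y} = 3 \<and>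
    (\<forall>a b c. b > 0 \<longrightarrow>
       mat (2 ^ (a + b + c + 1)) ** (x ** mat v - y ** mat t) ** mat (t ^ a * u ^ b * v ^ c) =
       ((ad y ^^ (2 * b - 1)) \<circ>> (ad x ^^ (2 * a + 1)) \<circ>> ((ad y \<circ>> ad x) ^^ c))
         (comm (comm x y) y)) \<and>
    (\<forall>a c.
       mat (2 ^ (a + c + 1)) ** (x ** mat v - y ** mat t) ** mat (t ^ a * v ^ c) =
       ((ad x ^^ (2 * a)) \<circ>> ((ad y \<circ>> ad x) ^^ c))
         (comm (comm x y) x)) \<and>
    (\<forall>a b c. a > 0 \<longrightarrow>
       mat (2 ^ (a + b + c + 1)) ** (x ** mat u - y ** mat v) ** mat (t ^ a * u ^ b * v ^ c) =
       ((ad x ^^ (2 * a - 1)) \<circ>> (ad y ^^ (2 * b + 1)) \<circ>> ((ad x \<circ>> ad y) ^^ c))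
         (comm (comm x y) x)) \<and>
    (\<forall>b c.
       mat (2 ^ (b + c + 1)) ** (x ** mat u - y ** mat v) ** mat (u ^ b * v ^ c) =
       ((ad y ^^ (2 * b)) \<circ>> ((ad x \<circ>> ad y) ^^ c))
         (comm (comm x y) y)) \<and>
    (\<forall>a b c.
       mat (2 ^ (a + b + c)) ** comm x y ** mat (t ^ a * u ^ b * v ^ c) =
       ((ad x ^^ (2 * a)) \<circ>> (ad y ^^ (2 * b)) \<circ>> ((ad x \<circ>> ad y) ^^ c))
         (comm x y))"
proof -
  define p where "p = x ** mat v - y ** mat t"
  define q where "q = x ** mat u - y ** mat v"
  define z where "z = comm x y"
  have "trace x = 0" "trace y = 0"
    by (simp_all add: assms(1,2) generic_x_def generic_y_def trace_def sum_2)
  then interpret traceless_pair x y t u v p q z W L L' Ktuv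
    by unfold_locales (use assms p_def q_def z_def in auto)
  have nz: "v * v \<noteq> t * u"
    unfolding assms(1-5) by (rule generic_discriminant)
  show ?thesis
    unfolding p_def [symmetric] q_def [symmetric] z_def [symmetric]
    using free_module [OF nz] distinct_gens [OF nz] p_word p_word_without_u q_word
      q_word_without_t z_word
    by (intro conjI allI impI) simp_all
qed

end
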